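(* Let $(L,\alpha)$ be a Hom-Lie-Yamaguti superalgebra over $\mathbb{K}$, and let $(f_t,g_t)$ and $(f'_t,g'_t)$ be two equivalent 1-parameter formal deformations of $L$, with $f_t=\sum_{i\ge0}f_it^i$, $g_t=\sum_{i\ge0}g_it^i$, $f'_t=\sum_{i\ge0}f'_it^i$, $g'_t=\sum_{i\ge0}g'_it^i$. Then the infinitesimal deformations $(f_1,g_1)$ and $(f'_1,g'_1)$ belong to the same cohomology class in $H^2(L,L)\times H^3(L,L)$.
   Context: $\mathbb{K}$ is an algebraically closed field of characteristic different from $2$ and $3$. $|x|\in\mathbb{Z}_2$ denotes the degree of a homogeneous element; identities are for homogeneous elements. $\circlearrowleft_{(x,y,z)}$ denotes the sum over cyclic permutations of $x,y,z$ (the sign prefactor is permuted too). A Hom-Lie-Yamaguti superalgebra $(L,[\cdot,\cdot],\{\cdot,\cdot,\cdot\},\alpha)$, denoted $(L,\alpha)$, is a $\mathbb{K}$-vector superspace $L$ with an even bilinear operation $[\cdot,\cdot]$, an even trilinear operation $\{\cdot,\cdot,\cdot\}$, and an even linear map $\alpha:L\to L$ such that for all homogeneous $x,y,z,u,v,w\in L$: - $\alpha([x,y])=[\alpha(x),\alpha(y)]$; - $\alpha(\{x,y,z\})=\{\alpha(x),\alpha(y),\alpha(z)\}$; - $[x,y]=-(-1)^{|x||y|}[y,x]$; - $\{x,y,z\}=-(-1)^{|x||y|}\{y,x,z\}$; - $\circlearrowleft_{(x,y,z)}(-1)^{|x||z|}([[x,y],\alpha(z)]+\{x,y,z\})=0$;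 - $\circlearrowleft_{(x,y,z)}(-1)^{|x||z|}\{[x,y],\alpha(z),\alpha(u)\}=0$; - $\{\alpha(x),\alpha(y),[u,v]\}=[\{x,y,u\},\alpha^2(v)]+(-1)^{|u|(|x|+|y|)}[\alpha^2(u),\{x,y,v\}]$; - $\{\alpha^2(x),\alpha^2(y),\{u,v,w\}\}=\{\{x,y,u\},\alpha^2(v),\alpha^2(w)\}+(-1)^{|u|(|x|+|y|)}\{\alpha^2(u),\{x,y,v\},\alpha^2(w)\}+(-1)^{(|u|+|v|)(|x|+|y|)}\{\alpha^2(u),\alpha^2(v),\{x,y,w\}\}$. The same definition is used over $\mathbb{K}[[t]]$ ($t$ even). Deformations. $L[[t]]$ is the $\mathbb{K}[[t]]$-module of formal power series with coefficients in $L$; maps on $L$ are extended $\mathbb{K}[[t]]$-(multi)linearly. A 1-parameter formal deformation of $L$ is a pair $f_t=\sum_{i\ge0}f_it^i$, $g_t=\sum_{i\ge0}g_it^i$ with $f_0=[\cdot,\cdot]$, $g_0=\{\cdot,\cdot,\cdot\}$, each $f_i:L\times L\to L$ even $\mathbb{K}$-bilinear and each $g_i:L\times L\times L\to L$ even $\mathbb{K}$-trilinear, such that $(L[[t]],f_t,g_t,\alpha)$ is a Hom-Lie-Yamaguti superalgebra over $\mathbb{K}[[t]]$. The pair $(f_1,g_1)$ is called the infinitesimal deformation of $(f_t,g_t)$. Two deformations $(f_t,g_t)$, $(f'_t,g'_t)$ are equivalent if there is a formal isomorphism of $\mathbb{K}[[t]]$-modules $\phi_t=\sum_{i\ge0}\phi_it^i:L[[t]]\to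 L[[t]]$ with $\phi_i:L\to L$ even $\mathbb{K}$-linear, $\phi_0=\mathrm{id}_L$, $\phi_t\circ\alpha=\alpha\circ\phi_t$, $\phi_t(f_t(x,y))=f'_t(\phi_t(x),\phi_t(y))$ and $\phi_t(g_t(x,y,z))=g'_t(\phi_t(x),\phi_t(y),\phi_t(z))$. Cohomology. $C^1(L,L)$: even linear $h:L\to L$ with $h\alpha=\alpha h$. $C^2(L,L)$: even bilinear $f:L\times L\to L$ with $f(x,y)=-(-1)^{|x||y|}f(y,x)$ and $\alpha(f(x,y))=f(\alpha(x),\alpha(y))$. $C^3(L,L)$: even trilinear $g$ with $g(x,y,z)=-(-1)^{|x||y|}g(y,x,z)$ and $\alpha(g(x,y,z))=g(\alpha(x),\alpha(y),\alpha(z))$. $Z^2(L,L)\times Z^3(L,L)$ denotes the space of pairs $(f,g)\in C^2(L,L)\times C^3(L,L)$ such that for all homogeneous $x,y,z,u,v,w$: - $\circlearrowleft_{(x,y,z)}(-1)^{|x||z|}\big([f(x,y),\alpha(z)]+f([x,y],\alpha(z))+g(x,y,z)\big)=0$; - $\circlearrowleft_{(x,y,z)}(-1)^{|x||z|}\big(\{f(x,y),\alpha(z),\alpha(u)\}+g([x,y],\alpha(z),\alpha(u))\big)=0$; - $\{\alpha(x),\alpha(y),f(u,v)\}+g(\alpha(x),\alpha(y),[u,v])=[g(x,y,u),\alpha^2(v)]+f(\{x,y,u\},\alpha^2(v))+(-1)^{|u|(|x|+|y|)}\big([\alpha^2(u),g(x,y,v)]+f(\alpha^2(u),\{x,y,v\})\big)$;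 - $\{\alpha^2(x),\alpha^2(y),g(u,v,w)\}+g(\alpha^2(x),\alpha^2(y),\{u,v,w\})=\{g(x,y,u),\alpha^2(v),\alpha^2(w)\}+g(\{x,y,u\},\alpha^2(v),\alpha^2(w))+(-1)^{|u|(|x|+|y|)}\big(\{\alpha^2(u),g(x,y,v),\alpha^2(w)\}+g(\alpha^2(u),\{x,y,v\},\alpha^2(w))\big)+(-1)^{(|u|+|v|)(|x|+|y|)}\big(\{\alpha^2(u),\alpha^2(v),g(x,y,w)\}+g(\alpha^2(u),\alpha^2(v),\{x,y,w\})\big)$. For $h\in C^1(L,L)$ put $\delta_I h(x,y)=[h(x),y]+[x,h(y)]-h([x,y])$ and $\delta_{II}h(x,y,z)=\{h(x),y,z\}+\{x,h(y),z\}+\{x,y,h(z)\}-h(\{x,y,z\})$. $B^2(L,L)\times B^3(L,L)$ denotes the space $\{(\delta_Ih,\delta_{II}h):h\in C^1(L,L)\}$, and $H^2(L,L)\times H^3(L,L):=(Z^2(L,L)\times Z^3(L,L))/(B^2(L,L)\times B^3(L,L))$ (single symbols for spaces of pairs, not Cartesian products of separately defined spaces). *)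

theory Defs
  imports
    "HOL-Library.Z2"
    "HOL-Library.Product_Plus"
    "HOL-Computational_Algebra.Computational_Algebra"
begin

section \<open>Superspaces\<close>

text \<open>
  The underlying group of a superspace is a whole type; \<open>G 0\<close> and \<open>G 1\<close> are its even and odd parts.
  The scalars form an arbitrary commutative ring, so that the same notions serve over a field
  (where a module is a vector space) and over its ring of formal power series.
\<close>

definition superspace ::
  "('k::comm_ring_1 \<Rightarrow> 'v::ab_group_add \<Rightarrow> 'v) \<Rightarrow> (bit \<Rightarrow> 'v set) \<Rightarrow> bool" where
  "superspace s G \<longleftrightarrow> module s \<and> (\<forall>d. module.subspace s (G d)) \<and> G 0 \<inter> G 1 = {0} \<and>
     (\<forall>x. \<exists>y\<in>G 0. \<exists>z\<in>G 1. x = y + z)"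

definition even_linear ::
  "('k::comm_ring_1 \<Rightarrow> 'v::ab_group_add \<Rightarrow> 'v) \<Rightarrow> (bit \<Rightarrow> 'v set) \<Rightarrow> ('v \<Rightarrow> 'v) \<Rightarrow> bool" where
  "even_linear s G h \<longleftrightarrow> module_hom s s h \<and> (\<forall>a. \<forall>x\<in>G a. h x \<in> G a)"

definition even_bilinear ::
  "('k::comm_ring_1 \<Rightarrow> 'v::ab_group_add \<Rightarrow> 'v) \<Rightarrow> (bit \<Rightarrow> 'v set) \<Rightarrow> ('v \<Rightarrow> 'v \<Rightarrow> 'v) \<Rightarrow> bool" where
  "even_bilinear s G f \<longleftrightarrow>
     (\<forall>y. module_hom s s (\<lambda>x. f x y)) \<and> (\<forall>x. module_hom s s (\<lambda>y. f x y)) \<and>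
     (\<forall>a b. \<forall>x\<in>G a. \<forall>y\<in>G b. f x y \<in> G (a + b))"

definition even_trilinear ::
  "('k::comm_ring_1 \<Rightarrow> 'v::ab_group_add \<Rightarrow> 'v) \<Rightarrow> (bit \<Rightarrow> 'v set) \<Rightarrow> ('v \<Rightarrow> 'v \<Rightarrow> 'v \<Rightarrow> 'v) \<Rightarrow> bool" where
  "even_trilinear s G g \<longleftrightarrow>
     (\<forall>y z. module_hom s s (\<lambda>x. g x y z)) \<and> (\<forall>x z. module_hom s s (\<lambda>y. g x y z)) \<and>
     (\<forall>x y. module_hom s s (\<lambda>z. g x y z)) \<and>
     (\<forall>a b c. \<forall>x\<in>G a. \<forall>y\<in>G b. \<forall>z\<in>G c. g x y z \<in> G (a + b + c))"

text \<open>\<open>ksign d v\<close> is $(-1)^d v$; exponents are computed in $\mathbb{Z}_2$.\<close>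

definition ksign :: "bit \<Rightarrow> 'v::ab_group_add \<Rightarrow> 'v" where
  "ksign d v = (if d = 0 then v else - v)"

text \<open>
  The cyclic sum of $(-1)^{|x||z|} F(x,y,z)$, where \<open>a\<close>, \<open>b\<close>, \<open>c\<close> are the degrees of
  \<open>x\<close>, \<open>y\<close>, \<open>z\<close>; the sign is permuted along with the arguments.
\<close>

definition cyclic_sum ::
  "bit \<Rightarrow> bit \<Rightarrow> bit \<Rightarrow> ('v \<Rightarrow> 'v \<Rightarrow> 'v \<Rightarrow> 'v::ab_group_add) \<Rightarrow> 'v \<Rightarrow> 'v \<Rightarrow> 'v \<Rightarrow> 'v" where
  "cyclic_sum a b c F x y z =
     ksign (a * c) (F x y z) + ksign (b * a) (F y z x) + ksign (c * b) (F z x y)"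

definition super_skew2 :: "(bit \<Rightarrow> 'v set) \<Rightarrow> ('v \<Rightarrow> 'v \<Rightarrow> 'v::ab_group_add) \<Rightarrow> bool" where
  "super_skew2 G f \<longleftrightarrow> (\<forall>a b. \<forall>x\<in>G a. \<forall>y\<in>G b. f x y = - ksign (a * b) (f y x))"

definition super_skew3 :: "(bit \<Rightarrow> 'v set) \<Rightarrow> ('v \<Rightarrow> 'v \<Rightarrow> 'v \<Rightarrow> 'v::ab_group_add) \<Rightarrow> bool" where
  "super_skew3 G g \<longleftrightarrow>
     (\<forall>a b c. \<forall>x\<in>G a. \<forall>y\<in>G b. \<forall>z\<in>G c. g x y z = - ksign (a * b) (g y x z))"


section \<open>Hom-Lie-Yamaguti superalgebras\<close>

definition hom_LY_superalgebra ::
  "('k::comm_ring_1 \<Rightarrow> 'v::ab_group_add \<Rightarrow> 'v) \<Rightarrow> (bit \<Rightarrow> 'v set) \<Rightarrow>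
   ('v \<Rightarrow> 'v \<Rightarrow> 'v) \<Rightarrow> ('v \<Rightarrow> 'v \<Rightarrow> 'v \<Rightarrow> 'v) \<Rightarrow> ('v \<Rightarrow> 'v) \<Rightarrow> bool" where
  "hom_LY_superalgebra s G br tr \<alpha> \<longleftrightarrow>
     superspace s G \<and> even_bilinear s G br \<and> even_trilinear s G tr \<and> even_linear s G \<alpha> \<and>
     (\<forall>a b. \<forall>x\<in>G a. \<forall>y\<in>G b. \<alpha> (br x y) = br (\<alpha> x) (\<alpha> y)) \<and>
     (\<forall>a b c. \<forall>x\<in>G a. \<forall>y\<in>G b. \<forall>z\<in>G c. \<alpha> (tr x y z) = tr (\<alpha> x) (\<alpha> y) (\<alpha> z)) \<and>
     super_skew2 G br \<and>
     super_skew3 G tr \<and>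
     (\<forall>a b c. \<forall>x\<in>G a. \<forall>y\<in>G b. \<forall>z\<in>G c.
        cyclic_sum a b c (\<lambda>x y z. br (br x y) (\<alpha> z) + tr x y z) x y z = 0) \<and>
     (\<forall>a b c d. \<forall>x\<in>G a. \<forall>y\<in>G b. \<forall>z\<in>G c. \<forall>u\<in>G d.
        cyclic_sum a b c (\<lambda>x y z. tr (br x y) (\<alpha> z) (\<alpha> u)) x y z = 0) \<and>
     (\<forall>a b c d. \<forall>x\<in>G a. \<forall>y\<in>G b. \<forall>u\<in>G c. \<forall>v\<in>G d.
        tr (\<alpha> x) (\<alpha> y) (br u v) =
          br (tr x y u) (\<alpha> (\<alpha> v)) + ksign (c * (a + b)) (br (\<alpha> (\<alpha> u)) (tr x y v))) \<and>
     (\<forall>a b c d e. \<forall>x\<in>G a. \<forall>y\<in>G b. \<forall>u\<in>G c. \<forall>v\<in>G d. \<forall>w\<in>G e.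
        tr (\<alpha> (\<alpha> x)) (\<alpha> (\<alpha> y)) (tr u v w) =
          tr (tr x y u) (\<alpha> (\<alpha> v)) (\<alpha> (\<alpha> w))
          + ksign (c * (a + b)) (tr (\<alpha> (\<alpha> u)) (tr x y v) (\<alpha> (\<alpha> w)))
          + ksign ((c + d) * (a + b)) (tr (\<alpha> (\<alpha> u)) (\<alpha> (\<alpha> v)) (tr x y w)))"


section \<open>Formal deformations\<close>

text \<open>
  $L[[t]]$ is the type \<open>'v fps\<close>: only its additive structure, coefficientwise, is used, so no
  multiplication on \<open>'v\<close> is needed. A series of (multi)linear maps acts on power series by the
  Cauchy product, which is its $\mathbb{K}[[t]]$-(multi)linear extension to $L[[t]]$.
\<close>

definition fps_scale :: "('k::comm_ring_1 \<Rightarrow> 'v::ab_group_add \<Rightarrow> 'v) \<Rightarrow> 'k fps \<Rightarrow> 'v fps \<Rightarrow> 'v fps" where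
  "fps_scale s c x = Abs_fps (\<lambda>n. \<Sum>i\<le>n. s (fps_nth c i) (fps_nth x (n - i)))"

definition fps_grading :: "(bit \<Rightarrow> 'v set) \<Rightarrow> bit \<Rightarrow> 'v fps set" where
  "fps_grading G d = {x. \<forall>n. fps_nth x n \<in> G d}"

definition fps_map :: "('v \<Rightarrow> 'v) \<Rightarrow> 'v fps \<Rightarrow> 'v fps" where
  "fps_map h x = Abs_fps (\<lambda>n. h (fps_nth x n))"

definition series1 :: "(nat \<Rightarrow> 'v \<Rightarrow> 'v::ab_group_add) \<Rightarrow> 'v fps \<Rightarrow> 'v fps" where
  "series1 \<phi> x = Abs_fps (\<lambda>n. \<Sum>i\<le>n. \<phi> i (fps_nth x (n - i)))"

definition series2 :: "(nat \<Rightarrow> 'v \<Rightarrow> 'v \<Rightarrow> 'v::ab_group_add) \<Rightarrow> 'v fps \<Rightarrow> 'v fps \<Rightarrow> 'v fps" where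
  "series2 f x y = Abs_fps (\<lambda>n. \<Sum>i\<le>n. \<Sum>j\<le>n - i. f i (fps_nth x j) (fps_nth y (n - i - j)))"

definition series3 ::
  "(nat \<Rightarrow> 'v \<Rightarrow> 'v \<Rightarrow> 'v \<Rightarrow> 'v::ab_group_add) \<Rightarrow> 'v fps \<Rightarrow> 'v fps \<Rightarrow> 'v fps \<Rightarrow> 'v fps" where
  "series3 g x y z = Abs_fps (\<lambda>n. \<Sum>i\<le>n. \<Sum>j\<le>n - i. \<Sum>k\<le>n - i - j.
     g i (fps_nth x j) (fps_nth y k) (fps_nth z (n - i - j - k)))"

definition formal_deformation ::
  "('k::comm_ring_1 \<Rightarrow> 'v::ab_group_add \<Rightarrow> 'v) \<Rightarrow> (bit \<Rightarrow> 'v set) \<Rightarrow>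
   ('v \<Rightarrow> 'v \<Rightarrow> 'v) \<Rightarrow> ('v \<Rightarrow> 'v \<Rightarrow> 'v \<Rightarrow> 'v) \<Rightarrow> ('v \<Rightarrow> 'v) \<Rightarrow>
   (nat \<Rightarrow> 'v \<Rightarrow> 'v \<Rightarrow> 'v) \<Rightarrow> (nat \<Rightarrow> 'v \<Rightarrow> 'v \<Rightarrow> 'v \<Rightarrow> 'v) \<Rightarrow> bool" where
  "formal_deformation s G br tr \<alpha> f g \<longleftrightarrow>
     f 0 = br \<and> g 0 = tr \<and> (\<forall>i. even_bilinear s G (f i)) \<and> (\<forall>i. even_trilinear s G (g i)) \<and>
     hom_LY_superalgebra (fps_scale s) (fps_grading G) (series2 f) (series3 g) (fps_map \<alpha>)"

definition infinitesimal ::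
  "(nat \<Rightarrow> 'v \<Rightarrow> 'v \<Rightarrow> 'v) \<Rightarrow> (nat \<Rightarrow> 'v \<Rightarrow> 'v \<Rightarrow> 'v \<Rightarrow> 'v) \<Rightarrow>
   ('v \<Rightarrow> 'v \<Rightarrow> 'v) \<times> ('v \<Rightarrow> 'v \<Rightarrow> 'v \<Rightarrow> 'v)" where
  "infinitesimal f g = (f 1, g 1)"

definition equivalent_deformations ::
  "('k::comm_ring_1 \<Rightarrow> 'v::ab_group_add \<Rightarrow> 'v) \<Rightarrow> (bit \<Rightarrow> 'v set) \<Rightarrow> ('v \<Rightarrow> 'v) \<Rightarrow>
   (nat \<Rightarrow> 'v \<Rightarrow> 'v \<Rightarrow> 'v) \<Rightarrow> (nat \<Rightarrow> 'v \<Rightarrow> 'v \<Rightarrow> 'v \<Rightarrow> 'v) \<Rightarrow>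
   (nat \<Rightarrow> 'v \<Rightarrow> 'v \<Rightarrow> 'v) \<Rightarrow> (nat \<Rightarrow> 'v \<Rightarrow> 'v \<Rightarrow> 'v \<Rightarrow> 'v) \<Rightarrow> bool" where
  "equivalent_deformations s G \<alpha> f g f' g' \<longleftrightarrow>
     (\<exists>\<phi>. (\<forall>i. even_linear s G (\<phi> i)) \<and> \<phi> 0 = id \<and>
        module_hom (fps_scale s) (fps_scale s) (series1 \<phi>) \<and> bij (series1 \<phi>) \<and>
        series1 \<phi> \<circ> fps_map \<alpha> = fps_map \<alpha> \<circ> series1 \<phi> \<and>
        (\<forall>x y. series1 \<phi> (series2 f x y) = series2 f' (series1 \<phi> x) (series1 \<phi> y)) \<and>
        (\<forall>x y z. series1 \<phi> (series3 g x y z) =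
           series3 g' (series1 \<phi> x) (series1 \<phi> y) (series1 \<phi> z)))"


section \<open>Cohomology\<close>

definition cochains1 ::
  "('k::comm_ring_1 \<Rightarrow> 'v::ab_group_add \<Rightarrow> 'v) \<Rightarrow> (bit \<Rightarrow> 'v set) \<Rightarrow> ('v \<Rightarrow> 'v) \<Rightarrow> ('v \<Rightarrow> 'v) set" where
  "cochains1 s G \<alpha> = {h. even_linear s G h \<and> h \<circ> \<alpha> = \<alpha> \<circ> h}"

definition cochains2 ::
  "('k::comm_ring_1 \<Rightarrow> 'v::ab_group_add \<Rightarrow> 'v) \<Rightarrow> (bit \<Rightarrow> 'v set) \<Rightarrow> ('v \<Rightarrow> 'v) \<Rightarrow>
   ('v \<Rightarrow> 'v \<Rightarrow> 'v) set" where
  "cochains2 s G \<alpha> = {f. even_bilinear s G f \<and> super_skew2 G f \<and>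
     (\<forall>x y. \<alpha> (f x y) = f (\<alpha> x) (\<alpha> y))}"

definition cochains3 ::
  "('k::comm_ring_1 \<Rightarrow> 'v::ab_group_add \<Rightarrow> 'v) \<Rightarrow> (bit \<Rightarrow> 'v set) \<Rightarrow> ('v \<Rightarrow> 'v) \<Rightarrow>
   ('v \<Rightarrow> 'v \<Rightarrow> 'v \<Rightarrow> 'v) set" where
  "cochains3 s G \<alpha> = {g. even_trilinear s G g \<and> super_skew3 G g \<and>
     (\<forall>x y z. \<alpha> (g x y z) = g (\<alpha> x) (\<alpha> y) (\<alpha> z))}"

definition cocycles23 ::
  "('k::comm_ring_1 \<Rightarrow> 'v::ab_group_add \<Rightarrow> 'v) \<Rightarrow> (bit \<Rightarrow> 'v set) \<Rightarrow>
   ('v \<Rightarrow> 'v \<Rightarrow> 'v) \<Rightarrow> ('v \<Rightarrow> 'v \<Rightarrow> 'v \<Rightarrow> 'v) \<Rightarrow> ('v \<Rightarrow> 'v) \<Rightarrow>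
   (('v \<Rightarrow> 'v \<Rightarrow> 'v) \<times> ('v \<Rightarrow> 'v \<Rightarrow> 'v \<Rightarrow> 'v)) set" where
  "cocycles23 s G br tr \<alpha> = {(f, g). f \<in> cochains2 s G \<alpha> \<and> g \<in> cochains3 s G \<alpha> \<and>
     (\<forall>a b c. \<forall>x\<in>G a. \<forall>y\<in>G b. \<forall>z\<in>G c.
        cyclic_sum a b c (\<lambda>x y z. br (f x y) (\<alpha> z) + f (br x y) (\<alpha> z) + g x y z) x y z = 0) \<and>
     (\<forall>a b c d. \<forall>x\<in>G a. \<forall>y\<in>G b. \<forall>z\<in>G c. \<forall>u\<in>G d.
        cyclic_sum a b c (\<lambda>x y z. tr (f x y) (\<alpha> z) (\<alpha> u) + g (br x y) (\<alpha> z) (\<alpha> u)) x y z = 0) \<and>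
     (\<forall>a b c d. \<forall>x\<in>G a. \<forall>y\<in>G b. \<forall>u\<in>G c. \<forall>v\<in>G d.
        tr (\<alpha> x) (\<alpha> y) (f u v) + g (\<alpha> x) (\<alpha> y) (br u v) =
          br (g x y u) (\<alpha> (\<alpha> v)) + f (tr x y u) (\<alpha> (\<alpha> v))
          + ksign (c * (a + b)) (br (\<alpha> (\<alpha> u)) (g x y v) + f (\<alpha> (\<alpha> u)) (tr x y v))) \<and>
     (\<forall>a b c d e. \<forall>x\<in>G a. \<forall>y\<in>G b. \<forall>u\<in>G c. \<forall>v\<in>G d. \<forall>w\<in>G e.
        tr (\<alpha> (\<alpha> x)) (\<alpha> (\<alpha> y)) (g u v w) + g (\<alpha> (\<alpha> x)) (\<alpha> (\<alpha> y)) (tr u v w) =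
          tr (g x y u) (\<alpha> (\<alpha> v)) (\<alpha> (\<alpha> w)) + g (tr x y u) (\<alpha> (\<alpha> v)) (\<alpha> (\<alpha> w))
          + ksign (c * (a + b))
              (tr (\<alpha> (\<alpha> u)) (g x y v) (\<alpha> (\<alpha> w)) + g (\<alpha> (\<alpha> u)) (tr x y v) (\<alpha> (\<alpha> w)))
          + ksign ((c + d) * (a + b))
              (tr (\<alpha> (\<alpha> u)) (\<alpha> (\<alpha> v)) (g x y w) + g (\<alpha> (\<alpha> u)) (\<alpha> (\<alpha> v)) (tr x y w)))}"

definition delta_I :: "('v \<Rightarrow> 'v \<Rightarrow> 'v::ab_group_add) \<Rightarrow> ('v \<Rightarrow> 'v) \<Rightarrow> 'v \<Rightarrow> 'v \<Rightarrow> 'v" where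
  "delta_I br h x y = br (h x) y + br x (h y) - h (br x y)"

definition delta_II ::
  "('v \<Rightarrow> 'v \<Rightarrow> 'v \<Rightarrow> 'v::ab_group_add) \<Rightarrow> ('v \<Rightarrow> 'v) \<Rightarrow> 'v \<Rightarrow> 'v \<Rightarrow> 'v \<Rightarrow> 'v" where
  "delta_II tr h x y z = tr (h x) y z + tr x (h y) z + tr x y (h z) - h (tr x y z)"

definition coboundaries23 ::
  "('k::comm_ring_1 \<Rightarrow> 'v::ab_group_add \<Rightarrow> 'v) \<Rightarrow> (bit \<Rightarrow> 'v set) \<Rightarrow>
   ('v \<Rightarrow> 'v \<Rightarrow> 'v) \<Rightarrow> ('v \<Rightarrow> 'v \<Rightarrow> 'v \<Rightarrow> 'v) \<Rightarrow> ('v \<Rightarrow> 'v) \<Rightarrow>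
   (('v \<Rightarrow> 'v \<Rightarrow> 'v) \<times> ('v \<Rightarrow> 'v \<Rightarrow> 'v \<Rightarrow> 'v)) set" where
  "coboundaries23 s G br tr \<alpha> = (\<lambda>h. (delta_I br h, delta_II tr h)) ` cochains1 s G \<alpha>"

text \<open>Pairs of maps are subtracted componentwise and pointwise.\<close>

definition cohomologous23 ::
  "('k::comm_ring_1 \<Rightarrow> 'v::ab_group_add \<Rightarrow> 'v) \<Rightarrow> (bit \<Rightarrow> 'v set) \<Rightarrow>
   ('v \<Rightarrow> 'v \<Rightarrow> 'v) \<Rightarrow> ('v \<Rightarrow> 'v \<Rightarrow> 'v \<Rightarrow> 'v) \<Rightarrow> ('v \<Rightarrow> 'v) \<Rightarrow>
   (('v \<Rightarrow> 'v \<Rightarrow> 'v) \<times> ('v \<Rightarrow> 'v \<Rightarrow> 'v \<Rightarrow> 'v)) rel" where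
  "cohomologous23 s G br tr \<alpha> =
     {(p, q). p \<in> cocycles23 s G br tr \<alpha> \<and> q \<in> cocycles23 s G br tr \<alpha> \<and>
       p - q \<in> coboundaries23 s G br tr \<alpha>}"

definition cohomology23 ::
  "('k::comm_ring_1 \<Rightarrow> 'v::ab_group_add \<Rightarrow> 'v) \<Rightarrow> (bit \<Rightarrow> 'v set) \<Rightarrow>
   ('v \<Rightarrow> 'v \<Rightarrow> 'v) \<Rightarrow> ('v \<Rightarrow> 'v \<Rightarrow> 'v \<Rightarrow> 'v) \<Rightarrow> ('v \<Rightarrow> 'v) \<Rightarrow>
   (('v \<Rightarrow> 'v \<Rightarrow> 'v) \<times> ('v \<Rightarrow> 'v \<Rightarrow> 'v \<Rightarrow> 'v)) set set" where
  "cohomology23 s G br tr \<alpha> = cocycles23 s G br tr \<alpha> // cohomologous23 s G br tr \<alpha>"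

end

theory Submission
  imports Defs
begin

text \<open>
  Write a subscript for the coefficient of a power of \<open>t\<close>. Everything happens modulo \<open>t\<^sup>2\<close>:
  evaluate the identities of a deformation at constant series and read off the coefficient
  of \<open>t\<close>. By (multi)additivity, the terms in which a higher coefficient of an argument
  occurs vanish, and a composite of two operations contributes exactly two terms, one for each
  place at which the single power of \<open>t\<close> can be spent; this is the Leibniz pattern in the cocycle
  conditions. Hence the axioms of a Hom-Lie-Yamaguti superalgebra, which hold for
  \<open>(f\<^sub>t, g\<^sub>t)\<close>, become the conditions that make \<open>(f\<^sub>1, g\<^sub>1)\<close> a cocycle
  (\<open>infinitesimal_in_cocycles23\<close>).

  In the same way \<open>\<phi>\<^sub>t (f\<^sub>t (x, y)) = f'\<^sub>t (\<phi>\<^sub>t x, \<phi>\<^sub>t y)\<close> becomes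
  \<open>f\<^sub>1 (x, y) + \<phi>\<^sub>1 [x, y] = f'\<^sub>1 (x, y) + [\<phi>\<^sub>1 x, y] + [x, \<phi>\<^sub>1 y]\<close>, and similarly for the ternary
  operation. So the difference of the two infinitesimals is the coboundary of the cochain
  \<open>\<phi>\<^sub>1\<close> (\<open>infinitesimal_diff_in_coboundaries23\<close>), and the class of
  \<open>(f\<^sub>1, g\<^sub>1)\<close> contains both.
\<close>

section \<open>Even multilinear maps\<close>

lemma even_linear_0: "even_linear s G h \<Longrightarrow> h 0 = 0"
  by (auto simp: even_linear_def intro: module_hom.zero)

lemma even_linear_add: "even_linear s G h \<Longrightarrow> h (x + y) = h x + h y"
  by (auto simp: even_linear_def intro: module_hom.add)

lemma even_bilinear_0:
  assumes "even_bilinear s G f"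
  shows "f 0 y = 0" "f x 0 = 0"
proof -
  have "module_hom s s (\<lambda>x. f x y)" "module_hom s s (\<lambda>y. f x y)"
    using assms by (auto simp: even_bilinear_def)
  from this[THEN module_hom.zero] show "f 0 y = 0" "f x 0 = 0" .
qed

lemma even_bilinear_add:
  assumes "even_bilinear s G f"
  shows "f (x + x') y = f x y + f x' y" "f x (y + y') = f x y + f x y'"
proof -
  have "module_hom s s (\<lambda>x. f x y)" "module_hom s s (\<lambda>y. f x y)"
    using assms by (auto simp: even_bilinear_def)
  from this[THEN module_hom.add]
  show "f (x + x') y = f x y + f x' y" "f x (y + y') = f x y + f x y'" .
qed

lemma even_trilinear_0:
  assumes "even_trilinear s G g"
  shows "g 0 y z = 0" "g x 0 z = 0" "g x y 0 = 0"
proof -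
  have "module_hom s s (\<lambda>x. g x y z)" "module_hom s s (\<lambda>y. g x y z)"
    "module_hom s s (\<lambda>z. g x y z)"
    using assms by (auto simp: even_trilinear_def)
  from this[THEN module_hom.zero] show "g 0 y z = 0" "g x 0 z = 0" "g x y 0 = 0" .
qed

lemma even_trilinear_add:
  assumes "even_trilinear s G g"
  shows "g (x + x') y z = g x y z + g x' y z" "g x (y + y') z = g x y z + g x y' z"
    "g x y (z + z') = g x y z + g x y z'"
proof -
  have "module_hom s s (\<lambda>x. g x y z)" "module_hom s s (\<lambda>y. g x y z)"
    "module_hom s s (\<lambda>z. g x y z)"
    using assms by (auto simp: even_trilinear_def)
  from this[THEN module_hom.add]
  show "g (x + x') y z = g x y z + g x' y z" "g x (y + y') z = g x y z + g x y' z"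
    "g x y (z + z') = g x y z + g x y z'" .
qed

lemma superspace_cases:
  assumes "superspace s G"
  obtains y z where "y \<in> G 0" "z \<in> G 1" "x = y + z"
  using assms unfolding superspace_def by blast

text \<open>
  A superalgebra is multiplicative on homogeneous elements, whereas cochains commute with
  \<open>\<alpha>\<close> on all elements; splitting each argument into its even and odd parts bridges the two.
\<close>

lemma even_bilinear_commute_ext:
  assumes "superspace s G" "even_linear s G \<alpha>" "even_bilinear s G f"
    and hom: "\<And>a b x y. x \<in> G a \<Longrightarrow> y \<in> G b \<Longrightarrow> \<alpha> (f x y) = f (\<alpha> x) (\<alpha> y)"
  shows "\<alpha> (f x y) = f (\<alpha> x) (\<alpha> y)"
proof -
  obtain x0 x1 where x: "x0 \<in> G 0" "x1 \<in> G 1" "x = x0 + x1"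
    using superspace_cases[OF assms(1)] by metis
  obtain y0 y1 where y: "y0 \<in> G 0" "y1 \<in> G 1" "y = y0 + y1"
    using superspace_cases[OF assms(1)] by metis
  show ?thesis
    using x y
    by (simp add: even_linear_add[OF assms(2)] even_bilinear_add[OF assms(3)] hom)
qed

lemma even_trilinear_commute_ext:
  assumes "superspace s G" "even_linear s G \<alpha>" "even_trilinear s G g"
    and hom: "\<And>a b c x y z. x \<in> G a \<Longrightarrow> y \<in> G b \<Longrightarrow> z \<in> G c \<Longrightarrow>
      \<alpha> (g x y z) = g (\<alpha> x) (\<alpha> y) (\<alpha> z)"
  shows "\<alpha> (g x y z) = g (\<alpha> x) (\<alpha> y) (\<alpha> z)"
proof -
  obtain x0 x1 where x: "x0 \<in> G 0" "x1 \<in> G 1" "x = x0 + x1"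
    using superspace_cases[OF assms(1)] by metis
  obtain y0 y1 where y: "y0 \<in> G 0" "y1 \<in> G 1" "y = y0 + y1"
    using superspace_cases[OF assms(1)] by metis
  obtain z0 z1 where z: "z0 \<in> G 0" "z1 \<in> G 1" "z = z0 + z1"
    using superspace_cases[OF assms(1)] by metis
  show ?thesis
    using x y z
    by (simp add: even_linear_add[OF assms(2)] even_trilinear_add[OF assms(3)] hom)
qed

section \<open>Coefficients of order at most one\<close>

lemma fps_nth_ksign: "fps_nth (ksign d X) n = ksign d (fps_nth X n)"
  by (simp add: ksign_def)

lemma fps_nth_map: "fps_nth (fps_map h X) n = h (fps_nth X n)"
  by (simp add: fps_map_def)

text \<open>
  In the order-one formulas the summands are ordered so that, once the terms with a zero argument
  drop out, an axiom for \<open>L[[t]]\<close> has its terms in the order of the corresponding cocycle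
  condition and the two match without rearrangement.
\<close>

lemma series1_nth_0: "fps_nth (series1 \<phi> X) 0 = \<phi> 0 (fps_nth X 0)"
  by (simp add: series1_def)

lemma series1_nth_1:
  "fps_nth (series1 \<phi> X) 1 = \<phi> 0 (fps_nth X 1) + \<phi> 1 (fps_nth X 0)"
  by (simp add: series1_def)

lemma series2_nth_0: "fps_nth (series2 f X Y) 0 = f 0 (fps_nth X 0) (fps_nth Y 0)"
  by (simp add: series2_def)

lemma series2_nth_1:
  "fps_nth (series2 f X Y) 1 =
     f 0 (fps_nth X 0) (fps_nth Y 1) + f 0 (fps_nth X 1) (fps_nth Y 0)
     + f 1 (fps_nth X 0) (fps_nth Y 0)"
  by (simp add: series2_def)

lemma series3_nth_0:
  "fps_nth (series3 g X Y Z) 0 = g 0 (fps_nth X 0) (fps_nth Y 0) (fps_nth Z 0)"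
  by (simp add: series3_def)

lemma series3_nth_1:
  "fps_nth (series3 g X Y Z) 1 =
     g 0 (fps_nth X 0) (fps_nth Y 0) (fps_nth Z 1) + g 0 (fps_nth X 0) (fps_nth Y 1) (fps_nth Z 0)
     + g 0 (fps_nth X 1) (fps_nth Y 0) (fps_nth Z 0)
     + g 1 (fps_nth X 0) (fps_nth Y 0) (fps_nth Z 0)"
  by (simp add: series3_def)

lemmas order1_nth =
  fps_nth_ksign fps_nth_map series1_nth_0 series1_nth_1 series2_nth_0 series2_nth_1
  series3_nth_0 series3_nth_1

lemma fps_const_in_grading:
  assumes "superspace s G" "x \<in> G d"
  shows "fps_const x \<in> fps_grading G d"
  using assms module.subspace_0[of s "G d"] by (auto simp: superspace_def fps_grading_def)

section \<open>Infinitesimals are cocycles\<close>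

lemma hom_LY_superalgebra_identities:
  assumes "hom_LY_superalgebra s G br tr \<alpha>"
  shows hom_LY_mult2: "\<forall>a b. \<forall>x\<in>G a. \<forall>y\<in>G b. \<alpha> (br x y) = br (\<alpha> x) (\<alpha> y)"
    and hom_LY_mult3: "\<forall>a b c. \<forall>x\<in>G a. \<forall>y\<in>G b. \<forall>z\<in>G c. \<alpha> (tr x y z) = tr (\<alpha> x) (\<alpha> y) (\<alpha> z)"
    and hom_LY_skew2: "super_skew2 G br"
    and hom_LY_skew3: "super_skew3 G tr"
    and hom_LY_cyclic: "\<forall>a b c. \<forall>x\<in>G a. \<forall>y\<in>G b. \<forall>z\<in>G c.
      cyclic_sum a b c (\<lambda>x y z. br (br x y) (\<alpha> z) + tr x y z) x y z = 0"
    and hom_LY_cyclic_tr: "\<forall>a b c d. \<forall>x\<in>G a. \<forall>y\<in>G b. \<forall>z\<in>G c. \<forall>u\<in>G d.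
      cyclic_sum a b c (\<lambda>x y z. tr (br x y) (\<alpha> z) (\<alpha> u)) x y z = 0"
    and hom_LY_der2: "\<forall>a b c d. \<forall>x\<in>G a. \<forall>y\<in>G b. \<forall>u\<in>G c. \<forall>v\<in>G d.
      tr (\<alpha> x) (\<alpha> y) (br u v) =
        br (tr x y u) (\<alpha> (\<alpha> v)) + ksign (c * (a + b)) (br (\<alpha> (\<alpha> u)) (tr x y v))"
    and hom_LY_der3: "\<forall>a b c d e. \<forall>x\<in>G a. \<forall>y\<in>G b. \<forall>u\<in>G c. \<forall>v\<in>G d. \<forall>w\<in>G e.
      tr (\<alpha> (\<alpha> x)) (\<alpha> (\<alpha> y)) (tr u v w) =
        tr (tr x y u) (\<alpha> (\<alpha> v)) (\<alpha> (\<alpha> w))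
        + ksign (c * (a + b)) (tr (\<alpha> (\<alpha> u)) (tr x y v) (\<alpha> (\<alpha> w)))
        + ksign ((c + d) * (a + b)) (tr (\<alpha> (\<alpha> u)) (\<alpha> (\<alpha> v)) (tr x y w))"
  using assms unfolding hom_LY_superalgebra_def by - (elim conjE, assumption)+

text \<open>
  Each cocycle condition is the coefficient of \<open>t\<close> of the axiom of the same shape for
  \<open>L[[t]]\<close>, taken at constant series of homogeneous elements, which are homogeneous.
\<close>

lemma infinitesimal_in_cocycles23:
  assumes L: "hom_LY_superalgebra s G br tr \<alpha>"
    and D: "formal_deformation s G br tr \<alpha> f g"
  shows "infinitesimal f g \<in> cocycles23 s G br tr \<alpha>"
proof -
  have ss: "superspace s G" and lin: "even_linear s G \<alpha>"
    using L by (auto simp: hom_LY_superalgebra_def)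
  have f0: "f 0 = br" and g0: "g 0 = tr"
    and bil: "\<And>i. even_bilinear s G (f i)" and tril: "\<And>i. even_trilinear s G (g i)"
    and Lt: "hom_LY_superalgebra (fps_scale s) (fps_grading G) (series2 f) (series3 g) (fps_map \<alpha>)"
    using D by (auto simp: formal_deformation_def)
  have bil0: "even_bilinear s G br" and tril0: "even_trilinear s G tr"
    using bil[of 0] tril[of 0] f0 g0 by simp_all
  note const = fps_const_in_grading[OF ss]
  note zeros = even_linear_0[OF lin] even_bilinear_0[OF bil] even_trilinear_0[OF tril]
    even_bilinear_0[OF bil0] even_trilinear_0[OF tril0]
  note coeff = arg_cong[where f = "\<lambda>X. fps_nth X 1"]
  note eval = order1_nth f0 g0 zeros
  have mult2: "\<alpha> (f 1 x y) = f 1 (\<alpha> x) (\<alpha> y)" if "x \<in> G a" "y \<in> G b" for x y a b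
    using coeff[OF hom_LY_mult2[OF Lt, rule_format, OF that[THEN const]]]
    by (simp add: eval del: One_nat_def)
  have mult3: "\<alpha> (g 1 x y z) = g 1 (\<alpha> x) (\<alpha> y) (\<alpha> z)"
    if "x \<in> G a" "y \<in> G b" "z \<in> G c" for x y z a b c
    using coeff[OF hom_LY_mult3[OF Lt, rule_format, OF that[THEN const]]]
    by (simp add: eval del: One_nat_def)
  have skew2: "super_skew2 G (f 1)"
    unfolding super_skew2_def
  proof (intro allI ballI)
    fix a b x y assume xy: "x \<in> G a" "y \<in> G b"
    show "f 1 x y = - ksign (a * b) (f 1 y x)"
      using coeff[OF hom_LY_skew2[OF Lt, unfolded super_skew2_def, rule_format, OF xy[THEN const]]]
      by (simp add: eval del: One_nat_def)
  qed
  have skew3: "super_skew3 G (g 1)"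
    unfolding super_skew3_def
  proof (intro allI ballI)
    fix a b c x y z assume xyz: "x \<in> G a" "y \<in> G b" "z \<in> G c"
    show "g 1 x y z = - ksign (a * b) (g 1 y x z)"
      using coeff[OF hom_LY_skew3[OF Lt, unfolded super_skew3_def, rule_format, OF xyz[THEN const]]]
      by (simp add: eval del: One_nat_def)
  qed
  have "\<alpha> (f 1 x y) = f 1 (\<alpha> x) (\<alpha> y)" for x y
    by (rule even_bilinear_commute_ext[OF ss lin bil]) (rule mult2)
  then have f1: "f 1 \<in> cochains2 s G \<alpha>"
    using bil skew2 by (simp add: cochains2_def)
  have "\<alpha> (g 1 x y z) = g 1 (\<alpha> x) (\<alpha> y) (\<alpha> z)" for x y z
    by (rule even_trilinear_commute_ext[OF ss lin tril]) (rule mult3)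
  then have g1: "g 1 \<in> cochains3 s G \<alpha>"
    using tril skew3 by (simp add: cochains3_def)
  have cyc3: "cyclic_sum a b c
      (\<lambda>x y z. br (f 1 x y) (\<alpha> z) + f 1 (br x y) (\<alpha> z) + g 1 x y z) x y z = 0"
    if "x \<in> G a" "y \<in> G b" "z \<in> G c" for x y z a b c
    using coeff[OF hom_LY_cyclic[OF Lt, rule_format, OF that[THEN const]]]
    by (simp add: cyclic_sum_def eval del: One_nat_def)
  have cyc4: "cyclic_sum a b c
      (\<lambda>x y z. tr (f 1 x y) (\<alpha> z) (\<alpha> u) + g 1 (br x y) (\<alpha> z) (\<alpha> u)) x y z = 0"
    if "x \<in> G a" "y \<in> G b" "z \<in> G c" "u \<in> G d" for x y z u a b c d
    using coeff[OF hom_LY_cyclic_tr[OF Lt, rule_format, OF that[THEN const]]]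
    by (simp add: cyclic_sum_def eval del: One_nat_def)
  have der2: "tr (\<alpha> x) (\<alpha> y) (f 1 u v) + g 1 (\<alpha> x) (\<alpha> y) (br u v) =
      br (g 1 x y u) (\<alpha> (\<alpha> v)) + f 1 (tr x y u) (\<alpha> (\<alpha> v))
      + ksign (c * (a + b)) (br (\<alpha> (\<alpha> u)) (g 1 x y v) + f 1 (\<alpha> (\<alpha> u)) (tr x y v))"
    if "x \<in> G a" "y \<in> G b" "u \<in> G c" "v \<in> G d" for x y u v a b c d
    using coeff[OF hom_LY_der2[OF Lt, rule_format, OF that[THEN const]]]
    by (simp add: eval del: One_nat_def)
  have der3: "tr (\<alpha> (\<alpha> x)) (\<alpha> (\<alpha> y)) (g 1 u v w) + g 1 (\<alpha> (\<alpha> x)) (\<alpha> (\<alpha> y)) (tr u v w) =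
      tr (g 1 x y u) (\<alpha> (\<alpha> v)) (\<alpha> (\<alpha> w)) + g 1 (tr x y u) (\<alpha> (\<alpha> v)) (\<alpha> (\<alpha> w))
      + ksign (c * (a + b))
          (tr (\<alpha> (\<alpha> u)) (g 1 x y v) (\<alpha> (\<alpha> w)) + g 1 (\<alpha> (\<alpha> u)) (tr x y v) (\<alpha> (\<alpha> w)))
      + ksign ((c + d) * (a + b))
          (tr (\<alpha> (\<alpha> u)) (\<alpha> (\<alpha> v)) (g 1 x y w) + g 1 (\<alpha> (\<alpha> u)) (\<alpha> (\<alpha> v)) (tr x y w))"
    if "x \<in> G a" "y \<in> G b" "u \<in> G c" "v \<in> G d" "w \<in> G e" for x y u v w a b c d e
    using coeff[OF hom_LY_der3[OF Lt, rule_format, OF that[THEN const]]]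
    by (simp add: eval del: One_nat_def)
  show ?thesis
    unfolding infinitesimal_def cocycles23_def
    by (intro CollectI case_prodI conjI allI ballI f1 g1;
        rule cyc3 cyc4 der2 der3; assumption)
qed

section \<open>Equivalent deformations have cohomologous infinitesimals\<close>

text \<open>
  The cochain is \<open>\<phi>\<^sub>1\<close>: since \<open>\<phi>\<^sub>0\<close> is the identity, each term with \<open>\<phi>\<^sub>1\<close> in the
  coefficient of \<open>t\<close> of an intertwining relation applies it just once, either to one argument or
  to the result, and these are the terms of the coboundary; and \<open>\<phi>\<^sub>1\<close> commutes with \<open>\<alpha>\<close>
  because \<open>\<phi>\<^sub>t\<close> does.
\<close>

lemma infinitesimal_diff_in_coboundaries23:
  assumes L: "hom_LY_superalgebra s G br tr \<alpha>"
    and D: "formal_deformation s G br tr \<alpha> f g"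
    and D': "formal_deformation s G br tr \<alpha> f' g'"
    and E: "equivalent_deformations s G \<alpha> f g f' g'"
  shows "infinitesimal f g - infinitesimal f' g' \<in> coboundaries23 s G br tr \<alpha>"
proof -
  have lin: "even_linear s G \<alpha>" and bil: "even_bilinear s G br" and tril: "even_trilinear s G tr"
    using L by (auto simp: hom_LY_superalgebra_def)
  have 0: "f 0 = br" "g 0 = tr" "f' 0 = br" "g' 0 = tr"
    using D D' by (auto simp: formal_deformation_def)
  obtain \<phi> where \<phi>: "\<And>i. even_linear s G (\<phi> i)" "\<phi> 0 = id"
    and \<alpha>: "series1 \<phi> \<circ> fps_map \<alpha> = fps_map \<alpha> \<circ> series1 \<phi>"
    and f: "\<And>x y. series1 \<phi> (series2 f x y) = series2 f' (series1 \<phi> x) (series1 \<phi> y)"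
    and g: "\<And>x y z. series1 \<phi> (series3 g x y z) =
      series3 g' (series1 \<phi> x) (series1 \<phi> y) (series1 \<phi> z)"
    using E unfolding equivalent_deformations_def by blast
  note coeff = arg_cong[where f = "\<lambda>X. fps_nth X 1"]
  note eval = order1_nth 0 \<phi>(2) even_linear_0[OF lin] even_bilinear_0[OF bil]
    even_trilinear_0[OF tril]
  have "\<phi> 1 (\<alpha> x) = \<alpha> (\<phi> 1 x)" for x
    using coeff[OF fun_cong[OF \<alpha>, of "fps_const x"]] by (simp add: eval del: One_nat_def)
  then have "\<phi> 1 \<in> cochains1 s G \<alpha>"
    using \<phi>(1) by (auto simp: cochains1_def)
  moreover have "f 1 x y - f' 1 x y = delta_I br (\<phi> 1) x y" for x y
    using coeff[OF f[of "fps_const x" "fps_const y"]]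
    by (simp add: eval delta_I_def algebra_simps del: One_nat_def)
  moreover have "g 1 x y z - g' 1 x y z = delta_II tr (\<phi> 1) x y z" for x y z
    using coeff[OF g[of "fps_const x" "fps_const y" "fps_const z"]]
    by (simp add: eval delta_II_def algebra_simps del: One_nat_def)
  ultimately show ?thesis
    unfolding coboundaries23_def infinitesimal_def by (auto simp: fun_eq_iff intro!: image_eqI)
qed

text \<open>
  The zero cochain has zero coboundary; this is what makes a cocycle cohomologous to itself.
\<close>

lemma diff_self_in_coboundaries23:
  assumes L: "hom_LY_superalgebra s G br tr \<alpha>"
  shows "p - p \<in> coboundaries23 s G br tr \<alpha>"
proof -
  have lin: "even_linear s G \<alpha>" and bil: "even_bilinear s G br" and tril: "even_trilinear s G tr"
    and M: "module s" and sub: "\<And>d. module.subspace s (G d)"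
    using L by (auto simp: hom_LY_superalgebra_def superspace_def)
  have "even_linear s G (\<lambda>x. 0)"
    using M module.subspace_0[OF M sub]
    by (simp add: even_linear_def module_hom_def module_hom_axioms_def module.scale_zero_right)
  then have "(\<lambda>x. 0) \<in> cochains1 s G \<alpha>"
    by (simp add: cochains1_def even_linear_0[OF lin] comp_def)
  moreover have "p - p = (delta_I br (\<lambda>x. 0), delta_II tr (\<lambda>x. 0))"
    by (simp add: prod_eq_iff fun_eq_iff delta_I_def delta_II_def even_bilinear_0[OF bil]
        even_trilinear_0[OF tril])
  ultimately show ?thesis
    unfolding coboundaries23_def by (intro rev_image_eqI[of "\<lambda>x. 0"])
qed

theorem theorem5p4:
  fixes s :: "'k::alg_closed_field \<Rightarrow> 'v::ab_group_add \<Rightarrow> 'v"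
    and G :: "bit \<Rightarrow> 'v set"
    and br :: "'v \<Rightarrow> 'v \<Rightarrow> 'v" and tr :: "'v \<Rightarrow> 'v \<Rightarrow> 'v \<Rightarrow> 'v" and \<alpha> :: "'v \<Rightarrow> 'v"
    and f f' :: "nat \<Rightarrow> 'v \<Rightarrow> 'v \<Rightarrow> 'v" and g g' :: "nat \<Rightarrow> 'v \<Rightarrow> 'v \<Rightarrow> 'v \<Rightarrow> 'v"
  assumes "CHAR('k) \<noteq> 2" and "CHAR('k) \<noteq> 3"
    and "hom_LY_superalgebra s G br tr \<alpha>"
    and "formal_deformation s G br tr \<alpha> f g"
    and "formal_deformation s G br tr \<alpha> f' g'"
    and "equivalent_deformations s G \<alpha> f g f' g'"
  shows "\<exists>C\<in>cohomology23 s G br tr \<alpha>. infinitesimal f g \<in> C \<and> infinitesimal f' g' \<in> C"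
proof -
  let ?R = "cohomologous23 s G br tr \<alpha>"
  have p: "infinitesimal f g \<in> cocycles23 s G br tr \<alpha>"
    and q: "infinitesimal f' g' \<in> cocycles23 s G br tr \<alpha>"
    using infinitesimal_in_cocycles23 assms(3-5) by blast+
  have "(infinitesimal f g, infinitesimal f g) \<in> ?R"
    using p diff_self_in_coboundaries23[OF assms(3)] by (simp add: cohomologous23_def del: diff_self)
  moreover have "(infinitesimal f g, infinitesimal f' g') \<in> ?R"
    using p q infinitesimal_diff_in_coboundaries23[OF assms(3-6)]
    by (simp add: cohomologous23_def)
  moreover have "?R `` {infinitesimal f g} \<in> cohomology23 s G br tr \<alpha>"
    using p by (simp add: cohomology23_def quotientI)
  ultimately show ?thesis by blast
qed

end
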